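(* For $\mathrm{Re}(x)>0$ we have $$J(x)+J\left(\frac1x\right)=\log^2(2).$$
   Context: For $\mathrm{Re}(x)>0$, $J(x)=\int_0^1\frac{\log(1+t^x)}{1+t}\,dt$ (principal logarithm). *)

theory Defs
  imports "HOL-Analysis.Analysis"
begin

text \<open>
  \<open>Ln\<close> is the principal branch. \<open>of_real t powr x\<close> is \<open>exp (x * ln t)\<close> for \<open>t > 0\<close>, and
  \<open>0 powr x = 0\<close>, which for \<open>Re x > 0\<close> is the limit as \<open>t\<close> tends to \<open>0\<close> from above; hence the
  integrand is continuous on \<open>{0..1}\<close> in that case. For other \<open>x\<close> the value of \<open>J\<close> carries no
  intended meaning.
\<close>

definition J :: "complex \<Rightarrow> complex" where
  "J x = integral {0..1::real} (\<lambda>t. Ln (1 + of_real t powr x) / (1 + of_real t))"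

end

theory Submission imports Defs "HOL-Complex_Analysis.Conformal_Mappings" "HOL-Real_Asymp.Real_Asymp"
begin

text \<open>
  For real \<open>x > 0\<close> the identity is integration by parts followed by the substitution
  \<open>u = t powr x\<close>. The product \<open>ln (1 + t powr x) * ln (1 + t)\<close> runs from \<open>0\<close> to \<open>(ln 2)\<^sup>2\<close> on the
  unit interval, and its derivative has two summands: the integrand of \<open>J x\<close>, and one that the
  substitution turns into the integrand of \<open>J (1 / x)\<close> (lemma \<open>J_reciprocal_of_real\<close>).

  For complex \<open>x\<close> the substitution would leave the real line, so the identity is instead continued
  analytically: \<open>J\<close> is holomorphic on the right half-plane (lemma \<open>holomorphic_J\<close>), inversion maps
  this half-plane to itself, and both sides agree on the positive real axis.
\<close>

section \<open>The integrand\<close>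

text \<open>
  In the closed unit disc only \<open>-1\<close> is translated by \<open>1\<close> out of the open right half-plane, and
  \<open>t powr x\<close> reaches the unit circle only for \<open>t = 1\<close>, where it equals \<open>1\<close>. So \<open>Ln\<close> is only ever
  evaluated away from its branch cut.
\<close>

lemma Re_one_plus_powr_pos:
  fixes x :: complex
  assumes "0 \<le> t" "t \<le> 1" "Re x > 0"
  shows "Re (1 + of_real t powr x) > 0"
proof (cases "t = 1")
  case False
  have "norm (complex_of_real t powr x) < 1"
  proof (cases "t = 0")
    case False
    with \<open>t \<noteq> 1\<close> assms have "t powr Re x < 1"
      using powr_less_mono2[of "Re x" t 1] by simp
    with assms show ?thesis
      by (subst norm_powr_real_powr) auto
  qed auto
  then show ?thesis
    using abs_Re_le_cmod[of "complex_of_real t powr x"] by simp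
qed auto

lemma one_plus_powr_notin_nonpos_Reals:
  fixes x :: complex
  assumes "0 \<le> t" "t \<le> 1" "Re x > 0"
  shows "1 + of_real t powr x \<notin> \<real>\<^sub>\<le>\<^sub>0"
  using Re_one_plus_powr_pos[OF assms] by (auto simp: complex_nonpos_Reals_iff)

lemma one_plus_of_real_nonzero:
  assumes "0 \<le> t"
  shows "1 + complex_of_real t \<noteq> 0"
proof -
  have "1 + complex_of_real t = of_real (1 + t)" by simp
  with assms show ?thesis by (simp only: of_real_eq_0_iff)
qed

lemma continuous_on_J_integrand:
  fixes x :: complex
  assumes "Re x > 0"
  shows "continuous_on {0..1} (\<lambda>t. Ln (1 + of_real t powr x) / (1 + of_real t))"
proof (intro continuous_intros)
  show "1 + complex_of_real t powr x \<notin> \<real>\<^sub>\<le>\<^sub>0" if "t \<in> {0..1}" for t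
    using that assms by (intro one_plus_powr_notin_nonpos_Reals) auto
qed (use assms one_plus_of_real_nonzero in \<open>auto intro!: continuous_on_powr_complex continuous_intros\<close>)

section \<open>Holomorphy on the right half-plane\<close>

lemma continuous_on_powr_mult_ln:
  fixes r :: real
  assumes "r > 0"
  shows "continuous_on {0..1} (\<lambda>t. t powr r * ln t)"
  unfolding continuous_on_eq_continuous_within
proof
  fix t :: real
  assume t: "t \<in> {0..1}"
  show "continuous (at t within {0..1}) (\<lambda>t. t powr r * ln t)"
  proof (cases "t = 0")
    case True
    have "((\<lambda>t. t powr r * ln t) \<longlongrightarrow> 0) (at_right 0)"
      using assms by real_asymp
    then have "((\<lambda>t. t powr r * ln t) \<longlongrightarrow> 0) (at 0 within {0..1})"
      by (simp add: at_within_Icc_at_right)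
    then show ?thesis
      by (simp add: True continuous_within)
  next
    case False
    then have "isCont (\<lambda>t. t powr r * ln t) t"
      by (intro continuous_intros) auto
    then show ?thesis
      by (rule continuous_at_imp_continuous_at_within)
  qed
qed

text \<open>
  Differentiation under the integral sign needs \<open>t powr x * ln t\<close> to be jointly continuous up to
  \<open>t = 0\<close>. On the half-plane \<open>Re x > r\<close> with \<open>r > 0\<close> this is seen by splitting it as
  \<open>(t powr r * ln t) * t powr (x - r)\<close>: the first factor is continuous in \<open>t\<close> alone, and the second
  one is jointly continuous, as its exponent has positive real part.
\<close>

lemma holomorphic_J_shifted_half_plane:
  fixes r :: real
  assumes "r > 0"
  shows "J holomorphic_on {x. Re x > r}"
proof -
  define D where "D = (\<lambda>(x::complex) (t::real). of_real (t powr r * ln t) * of_real t powr (x - of_real r)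
                       / (1 + of_real t powr x) / (1 + of_real t))"
  have "(\<lambda>x. integral (cbox 0 1) (\<lambda>t::real. Ln (1 + of_real t powr x) / (1 + of_real t)))
          holomorphic_on {x. Re x > r}"
  proof (rule leibniz_rule_holomorphic)
    fix x :: complex and t :: real
    assume x: "x \<in> {x. Re x > r}" and t: "t \<in> cbox 0 1"
    have nz: "1 + complex_of_real t powr x \<notin> \<real>\<^sub>\<le>\<^sub>0"
      using x t assms by (intro one_plus_powr_notin_nonpos_Reals) auto
    show "((\<lambda>x. Ln (1 + of_real t powr x) / (1 + of_real t)) has_field_derivative D x t)
            (at x within {x. Re x > r})"
    proof (cases "t = 0")
      case True
      then show ?thesis by (simp add: D_def)
    next
      case False
      with t have "t > 0" by auto
      have D_eq: "D x t = of_real t powr x * Ln (of_real t) / (1 + of_real t powr x) / (1 + of_real t)"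
        using \<open>t > 0\<close> by (simp add: D_def powr_diff powr_of_real Ln_of_real)
      have "((\<lambda>x. of_real t powr x) has_field_derivative Ln (of_real t) * of_real t powr x)
              (at x within {x. Re x > r})"
        using \<open>t > 0\<close> by (intro has_field_derivative_at_within[OF has_field_derivative_powr_right]) auto
      then have "((\<lambda>x. Ln (1 + of_real t powr x)) has_field_derivative
              inverse (1 + of_real t powr x) * (Ln (of_real t) * of_real t powr x))
              (at x within {x. Re x > r})"
        using nz by (auto intro!: derivative_eq_intros)
      then show ?thesis
        unfolding D_eq by (rule DERIV_cdivide[THEN DERIV_cong]) (simp add: field_simps)
    qed
  next
    fix x :: complex
    assume "x \<in> {x. Re x > r}"
    with assms show "(\<lambda>t::real. Ln (1 + of_real t powr x) / (1 + of_real t)) integrable_on cbox 0 1"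
      using integrable_continuous_interval[OF continuous_on_J_integrand[of x]] by auto
  next
    let ?A = "{x::complex. Re x > r} \<times> cbox (0::real) 1"
    have 1: "continuous_on ?A (\<lambda>p. complex_of_real (snd p powr r * ln (snd p)))"
      by (intro continuous_on_of_real
            continuous_on_compose2[OF continuous_on_powr_mult_ln[OF assms] continuous_on_snd[OF continuous_on_id]]) auto
    have 2: "continuous_on ?A (\<lambda>p. complex_of_real (snd p) powr (fst p - of_real r))"
      by (rule continuous_on_powr_complex) (auto intro!: continuous_intros)
    have 3: "continuous_on ?A (\<lambda>p. complex_of_real (snd p) powr fst p)"
      using assms by (intro continuous_on_powr_complex) (auto intro!: continuous_intros)
    have nz: "1 + complex_of_real t powr x \<noteq> 0" if "(x, t) \<in> ?A" for x t
      using that assms Re_one_plus_powr_pos[of t x] by fastforce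
    show "continuous_on ?A (\<lambda>(x, t). D x t)"
      unfolding D_def case_prod_unfold
      by (intro continuous_on_divide continuous_on_mult continuous_on_add continuous_on_const
            1 2 3 continuous_on_of_real continuous_on_snd continuous_on_id)
        (use nz one_plus_of_real_nonzero in auto)
  qed (rule convex_halfspace_Re_gt)
  then show ?thesis
    by (simp add: J_def[abs_def])
qed

lemma holomorphic_J: "J holomorphic_on {x. Re x > 0}"
proof -
  have "J holomorphic_on (\<Union>r\<in>{0<..}. {x. Re x > r})"
    by (rule holomorphic_on_UN_open) (auto simp: holomorphic_J_shifted_half_plane open_halfspace_Re_gt)
  also have "(\<Union>r\<in>{0<..}. {x. Re x > r}) = {x. Re x > 0}"
    using dense by (force intro: less_trans)
  finally show ?thesis .
qed

section \<open>The identity on the positive real axis\<close>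

lemma continuous_on_real_integrand:
  fixes a :: real
  assumes "a > 0"
  shows "continuous_on {0..1} (\<lambda>t. ln (1 + t powr a) / (1 + t))"
proof -
  have "1 + t powr a \<noteq> 0" for t :: real
    using powr_ge_zero[of t a] by linarith
  with assms show ?thesis
    by (auto intro!: continuous_intros continuous_on_powr')
qed

lemma J_of_real:
  fixes a :: real
  assumes "a > 0"
  shows "J (of_real a) = of_real (integral {0..1} (\<lambda>t. ln (1 + t powr a) / (1 + t)))"
proof -
  have "((\<lambda>t. complex_of_real (ln (1 + t powr a) / (1 + t))) has_integral
          of_real (integral {0..1} (\<lambda>t. ln (1 + t powr a) / (1 + t)))) {0..1}"
    using continuous_on_real_integrand[OF assms]
    by (intro has_integral_of_real integrable_integral integrable_continuous_interval)
  moreover have "complex_of_real (ln (1 + t powr a) / (1 + t))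
        = Ln (1 + of_real t powr of_real a) / (1 + of_real t)" if "t \<in> {0..1}" for t
  proof -
    have "1 + t powr a > 0" using powr_ge_zero[of t a] by linarith
    then show ?thesis
      using that by (simp add: powr_of_real Ln_of_real[symmetric])
  qed
  ultimately have "((\<lambda>t. Ln (1 + of_real t powr of_real a) / (1 + of_real t)) has_integral
          complex_of_real (integral {0..1} (\<lambda>t. ln (1 + t powr a) / (1 + t)))) {0..1}"
    by (rule has_integral_eq[rotated])
  then show ?thesis
    unfolding J_def by (rule integral_unique)
qed

lemma J_reciprocal_of_real:
  fixes a :: real
  assumes a: "a > 0"
  shows "J (of_real a) + J (1 / of_real a) = (Ln 2)\<^sup>2"
proof -
  define f where "f = (\<lambda>b t::real. ln (1 + t powr b) / (1 + t))"
  define h where "h = (\<lambda>t::real. ln (1 + t) * (a * t powr (a - 1)) / (1 + t powr a))"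
  have pos: "1 + t powr a > 0" for t :: real
    using powr_ge_zero[of t a] by linarith
  have f_int: "(f b has_integral integral {0..1} (f b)) {0..1}" if "b > 0" for b
    using continuous_on_real_integrand[OF that]
    by (intro integrable_integral integrable_continuous_interval) (simp add: f_def)
  \<comment> \<open>For \<open>a < 1\<close> the function \<open>t powr a\<close> is not differentiable at \<open>0\<close>, so integration by parts and
    the substitution below both use versions that require only continuity there.\<close>
  have "((\<lambda>t. f a t + h t) has_integral
          ln (1 + 1 powr a) * ln (1 + 1) - ln (1 + 0 powr a) * ln (1 + 0)) {0..1}"
  proof (rule fundamental_theorem_of_calculus_interior)
    show "continuous_on {0..1} (\<lambda>t. ln (1 + t powr a) * ln (1 + t))"
      using a less_imp_neq[OF pos] by (auto intro!: continuous_intros continuous_on_powr')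
    show "((\<lambda>t. ln (1 + t powr a) * ln (1 + t)) has_vector_derivative f a t + h t) (at t)"
      if "t \<in> {0<..<1}" for t
      unfolding has_real_derivative_iff_has_vector_derivative[symmetric] f_def h_def
      using that pos[of t] by (auto intro!: derivative_eq_intros simp: field_simps powr_diff)
  qed auto
  then have parts: "((\<lambda>t. f a t + h t) has_integral (ln 2)\<^sup>2) {0..1}"
    by (simp add: power2_eq_square)
  have "((\<lambda>t. (a * t powr (a - 1)) *\<^sub>R f (1 / a) (t powr a)) has_integral
          integral {0 powr a..1 powr a} (f (1 / a))) {0..1}"
  proof (rule has_integral_substitution_strong[where s = "{0}" and c = 0 and d = 1])
    show "continuous_on {0..1} (f (1 / a))"
      unfolding f_def using a by (intro continuous_on_real_integrand) auto
    show "continuous_on {0..1} (\<lambda>t. t powr a)"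
      using a by (intro continuous_on_powr' continuous_on_id continuous_on_const) auto
    show "((\<lambda>t. t powr a) has_real_derivative a * t powr (a - 1)) (at t within {0..1})"
      if "t \<in> {0..1} - {0}" for t
      using that by (auto intro!: derivative_eq_intros simp: powr_diff)
    show "(\<lambda>t. t powr a) ` {0..1} \<subseteq> {0..1}"
      using a by (auto intro!: powr_le1)
  qed (use a in auto)
  moreover have "(a * t powr (a - 1)) *\<^sub>R f (1 / a) (t powr a) = h t" if "t \<in> {0..1}" for t
    using that a by (simp add: f_def h_def powr_powr)
  ultimately have "(h has_integral integral {0 powr a..1 powr a} (f (1 / a))) {0..1}"
    by (rule has_integral_eq[rotated])
  then have subst: "(h has_integral integral {0..1} (f (1 / a))) {0..1}"
    by simp
  have "integral {0..1} (f a) + integral {0..1} (f (1 / a)) = (ln 2)\<^sup>2"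
    using has_integral_unique[OF has_integral_add[OF f_int[OF a] subst] parts] .
  moreover have "J (1 / of_real a) = of_real (integral {0..1} (f (1 / a)))"
    using J_of_real[of "1 / a"] a by (simp add: f_def)
  moreover have "J (of_real a) = of_real (integral {0..1} (f a))"
    using J_of_real[OF a] by (simp add: f_def)
  moreover have "Ln 2 = of_real (ln 2)"
    using Ln_of_real[of 2] by simp
  ultimately show ?thesis
    by (metis of_real_add of_real_power)
qed

section \<open>Analytic continuation\<close>

theorem theorem3p1:
  fixes x :: complex
  assumes "Re x > 0"
  shows "J x + J (1 / x) = (Ln 2)\<^sup>2"
proof -
  let ?H = "{z. Re z > 0}"
  have inv: "(\<lambda>z. 1 / z) holomorphic_on ?H"
    by (intro holomorphic_intros) auto
  have "(\<lambda>z::complex. 1 / z) ` ?H \<subseteq> ?H"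
    by (auto simp: Re_divide)
      (metis not_sum_power2_lt_zero less_numeral_extra(3) linorder_neqE_linordered_idom
         sum_power2_gt_zero_iff zero_less_divide_iff)
  then have "(\<lambda>z. J (1 / z)) holomorphic_on ?H"
    using holomorphic_on_compose_gen[OF inv holomorphic_J] by (simp add: o_def)
  then have hol: "(\<lambda>z. J z + J (1 / z) - (Ln 2)\<^sup>2) holomorphic_on ?H"
    by (intro holomorphic_intros holomorphic_J)
  have lim: "(1::complex) islimpt of_real ` {0<..}"
    unfolding islimpt_approachable
  proof (intro allI impI)
    fix e :: real
    assume "e > 0"
    then show "\<exists>z\<in>of_real ` {0<..}. z \<noteq> (1::complex) \<and> dist z 1 < e"
      by (intro bexI[of _ "of_real (1 + e / 2)"] imageI) (auto simp: dist_norm)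
  qed
  have "J x + J (1 / x) - (Ln 2)\<^sup>2 = 0"
  proof (rule analytic_continuation[OF hol, where U = "of_real ` {0<..}" and \<xi> = 1])
    show "connected ?H"
      by (intro convex_connected convex_halfspace_Re_gt)
  qed (use assms lim J_reciprocal_of_real in \<open>auto simp: open_halfspace_Re_gt\<close>)
  then show ?thesis by simp
qed

end
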